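(* Let $G=(\mathcal V,\mathcal E,\mathcal P)$ be a (finite) pinned $2$-dimensional simplicial complex with pin set $\mathcal P\subset\mathcal V$, with triangle set $\mathcal E_2$. Suppose that for every $T\in\mathcal E_2$ there exists an edge $\{v,w\}\subset T$ such that $\{v,w\}\not\subset\mathcal P$ and such that for all $T'\in\mathcal E_2$ with $T'\neq T$ one has $\{v,w\}\not\subset T'$. Then length-area transferal holds for $G$.
   Context: A hypergraph is a pair $(\mathcal V,\mathcal E)$ with $\mathcal V$ a finite set (vertices) and $\mathcal E\subset 2^{\mathcal V}$ (hyperedges). It is a simplicial complex if whenever $e\in\mathcal E$ and $f\subset e$ with $|f|>1$, then $f\in\mathcal E$; it is $2$-dimensional when all hyperedges have cardinality $2$ or $3$. $\mathcal E_1$ is the set of hyperedges of cardinality $2$ (edges), $\mathcal E_2$ the set of hyperedges of cardinality $3$ (triangles, or $2$-simplices). An edge is pinned if both of its vertices lie in $\mathcal P$; let $\mathcal E_1^{\mathrm{un}}\subset\mathcal E_1$ be the set of unpinned edges. Let $\alpha(x,y,z)=-\frac{x^2}{2}-\frac{y^2}{2}-\frac{z^2}{2}+xy+xz+yz$. Given fixed ("frozen") positive values $s=(s_e)$ for the pinned edges $e\in\mathcal E_1\setminus\mathcal E_1^{\mathrm{un}}$, the length-to-area map is $\Phi_s:\mathbb R^{\mathcal E_1^{\mathrm{un}}}\to\mathbb R^{\mathcal E_2}$, whose coordinate at $T=\{u,v,w\}$ is $\alpha(t_{\{u,v\}},t_{\{u,w\}},t_{\{v,w\}})$, where $t_e$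 is replaced by $s_e$ for pinned edges $e$. Length-area transferal holds for the pinned complex $G$ if for every choice of positive frozen values $s$ there is an input $t\in\mathbb R^{\mathcal E_1^{\mathrm{un}}}$ at which the derivative matrix $D\Phi_s(t)$ (with respect to the unpinned edge variables only) has full row rank $|\mathcal E_2|$. *)

theory Defs
  imports "HOL-Analysis.Analysis" "Jordan_Normal_Form.DL_Rank"
begin

definition hypergraph :: "'v set \<Rightarrow> 'v set set \<Rightarrow> bool" where
  "hypergraph V E \<longleftrightarrow> finite V \<and> E \<subseteq> Pow V"

definition simplicial_complex :: "'v set \<Rightarrow> 'v set set \<Rightarrow> bool" where
  "simplicial_complex V E \<longleftrightarrow>
     hypergraph V E \<and> (\<forall>e\<in>E. \<forall>f. f \<subseteq> e \<and> card f > 1 \<longrightarrow> f \<in> E)"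

definition two_dimensional :: "'v set set \<Rightarrow> bool" where
  "two_dimensional E \<longleftrightarrow> (\<forall>e\<in>E. card e = 2 \<or> card e = 3)"

definition pinned_two_complex :: "'v set \<Rightarrow> 'v set set \<Rightarrow> 'v set \<Rightarrow> bool" where
  "pinned_two_complex V E P \<longleftrightarrow>
     simplicial_complex V E \<and> two_dimensional E \<and> P \<subseteq> V"

definition edges :: "'v set set \<Rightarrow> 'v set set" where
  "edges E = {e \<in> E. card e = 2}"

definition triangles :: "'v set set \<Rightarrow> 'v set set" where
  "triangles E = {T \<in> E. card T = 3}"

definition unpinned_edges :: "'v set set \<Rightarrow> 'v set \<Rightarrow> 'v set set" where
  "unpinned_edges E P = {e \<in> edges E. \<not> e \<subseteq> P}"

definition alpha :: "real \<Rightarrow> real \<Rightarrow> real \<Rightarrow> real" where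
  "alpha x y z = - (x^2 / 2) - y^2 / 2 - z^2 / 2 + x * y + x * z + y * z"

text \<open>
  The value of \<^const>\<open>alpha\<close> on the three sides of a triangle, for an arbitrary labelling
  \<open>u, v, w\<close> of its vertices. It is unique because \<^const>\<open>alpha\<close> is symmetric; see
  \<open>triangle_alpha_eq\<close> below.
\<close>
definition triangle_alpha :: "('v set \<Rightarrow> real) \<Rightarrow> 'v set \<Rightarrow> real" where
  "triangle_alpha l T =
     (THE a. \<exists>u v w. T = {u, v, w} \<and> a = alpha (l {u, v}) (l {u, w}) (l {v, w}))"

lemma triangle_alpha_eq:
  assumes "u \<noteq> v" "u \<noteq> w" "v \<noteq> w"
  shows "triangle_alpha l {u, v, w} = alpha (l {u, v}) (l {u, w}) (l {v, w})"
  unfolding triangle_alpha_def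
proof (rule the_equality)
  show "\<exists>u' v' w'. {u, v, w} = {u', v', w'} \<and>
      alpha (l {u, v}) (l {u, w}) (l {v, w}) = alpha (l {u', v'}) (l {u', w'}) (l {v', w'})"
    by blast
next
  fix a
  assume "\<exists>u' v' w'. {u, v, w} = {u', v', w'} \<and> a = alpha (l {u', v'}) (l {u', w'}) (l {v', w'})"
  then obtain x y z where eq: "{u, v, w} = {x, y, z}"
    and a: "a = alpha (l {x, y}) (l {x, z}) (l {y, z})"
    by blast
  have "x \<in> {u, v, w}" "y \<in> {u, v, w}" "z \<in> {u, v, w}"
    using eq by simp_all
  moreover have "card {x, y, z} = 3"
    using assms unfolding eq[symmetric] by simp
  then have "x \<noteq> y" "x \<noteq> z" "y \<noteq> z"
    by (auto simp: card_insert_if split: if_splits)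
  ultimately show "a = alpha (l {u, v}) (l {u, w}) (l {v, w})"
    unfolding a by (auto simp: alpha_def insert_commute)
qed

text \<open>
  A point of the coordinate space indexed by a set \<open>A\<close> is an element of
  \<open>A \<rightarrow>\<^sub>E UNIV\<close>, that is, a function that is \<open>undefined\<close> outside \<open>A\<close>.
\<close>
definition length_to_area ::
  "'v set set \<Rightarrow> 'v set \<Rightarrow> ('v set \<Rightarrow> real) \<Rightarrow> ('v set \<Rightarrow> real) \<Rightarrow> ('v set \<Rightarrow> real)" where
  "length_to_area E P s t =
     (\<lambda>T\<in>triangles E. triangle_alpha (\<lambda>e. if e \<in> unpinned_edges E P then t e else s e) T)"

definition enumeration :: "'b set \<Rightarrow> 'b list" where
  "enumeration A = (SOME xs. distinct xs \<and> set xs = A)"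

lemma enumeration:
  assumes "finite A"
  shows "distinct (enumeration A)" "set (enumeration A) = A" "length (enumeration A) = card A"
proof -
  have "\<exists>xs. distinct xs \<and> set xs = A"
    using finite_distinct_list[OF assms] by blast
  then have *: "distinct (enumeration A) \<and> set (enumeration A) = A"
    unfolding enumeration_def by (rule someI_ex)
  then show "distinct (enumeration A)" "set (enumeration A) = A" by auto
  from * show "length (enumeration A) = card A" using distinct_card by fastforce
qed

text \<open>
  The matrix of partial derivatives at \<open>t\<close> of a map \<open>F\<close> between the coordinate spaces
  indexed by the finite sets \<open>A\<close> and \<open>B\<close>: rows are indexed by \<open>B\<close> and columns by \<open>A\<close>, in some
  arbitrary but fixed order (the rank does not depend on it).
\<close>
definition derivative_matrix ::
  "'a set \<Rightarrow> 'b set \<Rightarrow> (('a \<Rightarrow> real) \<Rightarrow> ('b \<Rightarrow> real)) \<Rightarrow> ('a \<Rightarrow> real) \<Rightarrow> real mat" where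
  "derivative_matrix A B F t =
     mat (card B) (card A)
       (\<lambda>(i, j). let a = enumeration A ! j; b = enumeration B ! i
                 in deriv (\<lambda>x. F (t(a := x)) b) (t a))"

definition length_area_transferal :: "'v set set \<Rightarrow> 'v set \<Rightarrow> bool" where
  "length_area_transferal E P \<longleftrightarrow>
     (\<forall>s. (\<forall>e \<in> edges E - unpinned_edges E P. s e > 0) \<longrightarrow>
        (\<exists>t \<in> unpinned_edges E P \<rightarrow>\<^sub>E UNIV.
           vec_space.rank (card (triangles E))
             (derivative_matrix (unpinned_edges E P) (triangles E) (length_to_area E P s) t)
           = card (triangles E)))"

end

theory Submission
  imports Defs
begin

text \<open>
  Choose for every triangle \<open>T\<close> a private unpinned edge \<open>e(T)\<close>, one that lies in no other
  triangle. In the derivative matrix, the column of \<open>e(T)\<close> vanishes outside row \<open>T\<close>, where it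
  contains \<open>l(f) + l(g) - l(e(T))\<close>, with \<open>f\<close> and \<open>g\<close> the other two edges of \<open>T\<close>. These are not of
  the form \<open>e(T')\<close>, so giving length 0 to the chosen edges and length 1 to all other
  unpinned edges makes this entry positive, whatever the frozen values. The columns then span
  the whole space.
\<close>

text \<open>A column whose only nonzero entry is in row \<open>i\<close> is a multiple of
  \<open>unit_vec n i\<close>. With one such column for every row, the column span contains the
  standard basis.\<close>

lemma rank_full_row:
  fixes A :: "'a :: field mat"
  assumes A: "A \<in> carrier_mat n nc"
    and col: "\<And>i. i < n \<Longrightarrow>
      \<exists>j<nc. A $$ (i, j) \<noteq> 0 \<and> (\<forall>i'<n. i' \<noteq> i \<longrightarrow> A $$ (i', j) = 0)"
  shows "vec_space.rank n A = n"
proof -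
  interpret vec_space "TYPE('a)" n .
  have cols: "set (cols A) \<subseteq> carrier_vec n"
    using cols_dim A by blast
  have "unit_vec n i \<in> span (set (cols A))" if i: "i < n" for i
  proof -
    from col[OF i] obtain j where j: "j < nc" "A $$ (i, j) \<noteq> 0"
      "\<And>i'. i' < n \<Longrightarrow> i' \<noteq> i \<Longrightarrow> A $$ (i', j) = 0"
      by blast
    have "col A j \<in> span (set (cols A))"
      using j A cols span_mem[OF cols] by (auto simp: cols_def)
    then have "inverse (A $$ (i, j)) \<cdot>\<^sub>v col A j \<in> span (set (cols A))"
      by (rule smult_in_span[OF cols])
    also have "inverse (A $$ (i, j)) \<cdot>\<^sub>v col A j = unit_vec n i"
      using j i A by (intro eq_vecI) (auto simp: unit_vec_def)
    finally show ?thesis .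
  qed
  then have "set (unit_vecs n) \<subseteq> span (set (cols A))"
    by (auto simp: unit_vecs_def)
  then have "span (set (unit_vecs n)) \<subseteq> span (set (cols A))"
    by (rule span_is_subset[OF _ span_is_submodule[OF cols]])
  then have "span (set (cols A)) = carrier_vec n"
    using span_is_subset2[OF cols] by (auto simp: span_unit_vecs_is_carrier)
  \<comment> \<open>The rank is the dimension of the column span, which is now all of
    \<open>carrier_vec n\<close>.\<close>
  then show ?thesis
    unfolding rank_def using dim_is_n by (simp add: module_vec_def)
qed

text \<open>Once the vertices are labelled, only the three two-element subsets of \<open>T\<close>
  enter. Hence the coordinate at \<open>T\<close> is constant in the variable of any edge not
  contained in \<open>T\<close>.\<close>

lemma triangle_alpha_cong:
  assumes "card T = 3" and "\<And>e. e \<subseteq> T \<Longrightarrow> card e = 2 \<Longrightarrow> l e = l' e"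
  shows "triangle_alpha l T = triangle_alpha l' T"
proof -
  obtain u v w where T: "T = {u, v, w}" "u \<noteq> v" "u \<noteq> w" "v \<noteq> w"
    using assms(1) by (auto simp: card_3_iff)
  show ?thesis
    unfolding T(1) triangle_alpha_eq[OF T(2-4)] using assms(2) T by simp
qed

lemma deriv_alpha: "deriv (\<lambda>x. alpha x y z) x = y + z - x"
  unfolding alpha_def by (rule DERIV_imp_deriv) (auto intro!: derivative_eq_intros)

lemma deriv_length_to_area_eq_0:
  assumes "T \<in> triangles E" and "\<not> e \<subseteq> T"
  shows "deriv (\<lambda>x. length_to_area E P s (t(e := x)) T) c = 0"
proof -
  have "length_to_area E P s (t(e := x)) T = length_to_area E P s t T" for x
    using assms unfolding length_to_area_def
    by (auto simp: triangles_def intro!: triangle_alpha_cong)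
  then show ?thesis by simp
qed

text \<open>As a function of the variable of \<open>e\<close>, the coordinate at \<open>T\<close> is
  \<open>alpha\<close> with the other two sides fixed. Its derivative at 0 is the sum of these two
  sides, both positive.\<close>

lemma deriv_length_to_area_pos:
  assumes sc: "simplicial_complex V E"
    and T: "T \<in> triangles E"
    and e: "e \<in> unpinned_edges E P" "e \<subseteq> T" "t e = 0"
    and pos: "\<And>f. f \<in> unpinned_edges E P \<Longrightarrow> f \<subseteq> T \<Longrightarrow> f \<noteq> e \<Longrightarrow> t f > 0"
    and s: "\<And>f. f \<in> edges E - unpinned_edges E P \<Longrightarrow> s f > 0"
  shows "deriv (\<lambda>x. length_to_area E P s (t(e := x)) T) (t e) > 0"
proof -
  have cT: "card T = 3" and "card e = 2"
    using T e by (auto simp: triangles_def unpinned_edges_def edges_def)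
  then obtain u v where uv: "e = {u, v}" "u \<noteq> v"
    by (auto simp: card_2_iff)
  have fin: "finite T"
    using cT by (simp add: card_ge_0_finite)
  have "card (T - e) = 1"
    using card_Diff_subset[of e T] fin e(2) cT \<open>card e = 2\<close> finite_subset[OF e(2)] by simp
  then obtain w where "T - e = {w}"
    by (auto simp: card_1_singleton_iff)
  then have Tw: "T = {u, v, w}" "u \<noteq> w" "v \<noteq> w"
    using e(2) uv by auto
  define l where "l = (\<lambda>f. if f \<in> unpinned_edges E P then t f else s f)"
  have l_pos: "l f > 0" if "f \<subseteq> T" "card f = 2" "f \<noteq> e" for f
  proof -
    \<comment> \<open>Closure under faces makes every side of \<open>T\<close> an edge, so its
      length is covered by either \<open>pos\<close> or \<open>s\<close>.\<close>
    have "f \<in> edges E"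
      using sc T that unfolding simplicial_complex_def triangles_def edges_def by auto
    then show ?thesis
      using pos s that unfolding l_def by auto
  qed
  \<comment> \<open>The update at \<open>e\<close> therefore leaves the other two sides
    unchanged.\<close>
  have ne: "{u, w} \<noteq> e" "{v, w} \<noteq> e"
    using uv Tw by (auto simp: doubleton_eq_iff)
  have "length_to_area E P s (t(e := x)) T = alpha x (l {u, w}) (l {v, w})" for x
    using T ne e(1) uv unfolding length_to_area_def Tw(1)
    by (simp add: triangle_alpha_eq[OF uv(2) Tw(2,3)] l_def)
  moreover have "l {u, w} > 0" "l {v, w} > 0"
    using l_pos ne Tw by auto
  ultimately show ?thesis
    by (simp add: deriv_alpha e(3))
qed

theorem proposition1p2:
  fixes V P :: "'v set" and E :: "'v set set"
  assumes "pinned_two_complex V E P"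
    and "\<forall>T \<in> triangles E. \<exists>v w. {v, w} \<in> edges E \<and> {v, w} \<subseteq> T \<and> \<not> {v, w} \<subseteq> P \<and>
           (\<forall>T' \<in> triangles E. T' \<noteq> T \<longrightarrow> \<not> {v, w} \<subseteq> T')"
  shows "length_area_transferal E P"
  unfolding length_area_transferal_def
proof (intro allI impI)
  fix s :: "'v set \<Rightarrow> real"
  assume s: "\<forall>e \<in> edges E - unpinned_edges E P. s e > 0"
  let ?U = "unpinned_edges E P" and ?T = "triangles E"
  have sc: "simplicial_complex V E"
    using assms(1) by (simp add: pinned_two_complex_def)
  then have "finite V" "E \<subseteq> Pow V"
    by (simp_all add: simplicial_complex_def hypergraph_def)
  then have "finite E"
    by (meson finite_Pow_iff finite_subset)
  then have fin: "finite ?T" "finite ?U"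
    by (simp_all add: triangles_def unpinned_edges_def edges_def)
  have "\<forall>T\<in>?T. \<exists>e\<in>?U. e \<subseteq> T \<and> (\<forall>T'\<in>?T. T' \<noteq> T \<longrightarrow> \<not> e \<subseteq> T')"
  proof
    fix T
    assume "T \<in> ?T"
    then obtain v w where "{v, w} \<in> edges E" "{v, w} \<subseteq> T" "\<not> {v, w} \<subseteq> P"
      and "\<forall>T'\<in>?T. T' \<noteq> T \<longrightarrow> \<not> {v, w} \<subseteq> T'"
      using assms(2) by meson
    then show "\<exists>e\<in>?U. e \<subseteq> T \<and> (\<forall>T'\<in>?T. T' \<noteq> T \<longrightarrow> \<not> e \<subseteq> T')"
      by (intro bexI[of _ "{v, w}"] conjI) (simp_all add: unpinned_edges_def)
  qed
  then obtain g where g: "\<And>T. T \<in> ?T \<Longrightarrow> g T \<in> ?U" "\<And>T. T \<in> ?T \<Longrightarrow> g T \<subseteq> T"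
    and priv: "\<And>T T'. T \<in> ?T \<Longrightarrow> T' \<in> ?T \<Longrightarrow> T' \<noteq> T \<Longrightarrow> \<not> g T \<subseteq> T'"
    by metis
  define t :: "'v set \<Rightarrow> real" where "t = (\<lambda>e\<in>?U. if e \<in> g ` ?T then 0 else 1)"
  let ?F = "length_to_area E P s"
  let ?M = "derivative_matrix ?U ?T ?F t"
  have M: "?M \<in> carrier_mat (card ?T) (card ?U)"
    by (simp add: derivative_matrix_def)
  have pos: "deriv (\<lambda>x. ?F (t(g T := x)) T) (t (g T)) > 0" if T: "T \<in> ?T" for T
  proof (rule deriv_length_to_area_pos[OF sc T g(1,2)[OF T]])
    show "t (g T) = 0"
      using T g by (simp add: t_def)
    \<comment> \<open>If \<open>f\<close> were \<open>g T'\<close> with \<open>T'\<close> different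
      from \<open>T\<close>, it would be private to \<open>T'\<close> and could not lie in
      \<open>T\<close>. So \<open>t f\<close> is 1.\<close>
    show "t f > 0" if "f \<in> ?U" "f \<subseteq> T" "f \<noteq> g T" for f
      using that T priv by (auto simp: t_def)
  qed (use s in blast)
  have "vec_space.rank (card ?T) ?M = card ?T"
  proof (rule rank_full_row[OF M])
    fix i
    assume i: "i < card ?T"
    define T where "T = enumeration ?T ! i"
    have T: "T \<in> ?T"
      unfolding T_def using enumeration[OF fin(1)] i nth_mem by metis
    \<comment> \<open>The column of the private edge of \<open>T\<close> is the witness for row
      \<open>i\<close>.\<close>
    then obtain j where j: "j < card ?U" "enumeration ?U ! j = g T"
      using g(1) enumeration[OF fin(2)] by (metis in_set_conv_nth)
    have "?M $$ (i, j) \<noteq> 0"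
      using pos[OF T] i j by (simp add: derivative_matrix_def Let_def T_def)
    moreover have "?M $$ (i', j) = 0" if i': "i' < card ?T" "i' \<noteq> i" for i'
    proof -
      have "enumeration ?T ! i' \<in> ?T"
        using enumeration[OF fin(1)] i' nth_mem by metis
      \<comment> \<open>The enumeration has no repetitions, so another row belongs to another
        triangle, which does not contain \<open>g T\<close>.\<close>
      moreover have "enumeration ?T ! i' \<noteq> T"
        unfolding T_def using enumeration[OF fin(1)] i i' by (simp add: nth_eq_iff_index_eq)
      ultimately show ?thesis
        using i' j priv[OF T]
        by (simp add: derivative_matrix_def Let_def deriv_length_to_area_eq_0)
    qed
    ultimately show "\<exists>j<card ?U. ?M $$ (i, j) \<noteq> 0 \<and>
        (\<forall>i'<card ?T. i' \<noteq> i \<longrightarrow> ?M $$ (i', j) = 0)"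
      using j(1) by blast
  qed
  then show "\<exists>t \<in> ?U \<rightarrow>\<^sub>E UNIV.
      vec_space.rank (card ?T) (derivative_matrix ?U ?T ?F t) = card ?T"
    by (intro bexI[of _ t]) (auto simp: t_def)
qed

end
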